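(* Let $n\ge2$ be an integer and $c\in\mathbb{R}\setminus\{0\}$. The following functions of $x\in\mathbb{C}$ satisfy the higher-order Scorer-type differential equation $$y^{(n-1)}(x)+c\,x\,y(x)=1,\qquad x\in\mathbb{C}:$$ (1) if $n$ is odd, or $n$ is even and $c<0$, $$f(x)=\int_0^\infty e^{-(-c)^{n-1}\frac{w^n}{n}-cwx}\,dw,\qquad g_k(x)=\int_0^\infty e^{-(-c)^{n-1}\frac{w^n}{n}-cwxa_k}\cos\Bigl(cwxb_k-\frac{2k\pi}{n}\Bigr)dw,$$ for every natural $1\le k\le n/2$, where $a_k=\cos(2k\pi/n)$ and $b_k=\sin(2k\pi/n)$; (2) if $n$ is even and $c>0$, $$f(x)=e^{i\frac{\pi}{n}}\int_0^\infty e^{(-c)^{n-1}\frac{w^n}{n}-cwxe^{i\pi/n}}\,dw,\qquad g_k(x)=\int_0^\infty e^{(-c)^{n-1}\frac{w^n}{n}-cwxa_k}\cos\Bigl(cwxb_k-\frac{2k+1}{n}\pi\Bigr)dw,$$ for every $k=0,\dots,\frac n2-1$, where $a_k=\cos((2k+1)\pi/n)$ and $b_k=\sin((2k+1)\pi/n)$.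
   Context: $y^{(j)}$ denotes the $j$-th derivative; sine and cosine of complex arguments are the usual entire functions. *)

theory Defs
  imports "HOL-Complex_Analysis.Complex_Analysis"
begin

text \<open>\<^term>\<open>deriv\<close> is total, so the existence of the derivatives up to order \<open>n - 1\<close> is part
  of the definition.\<close>

definition scorer_solution :: "nat \<Rightarrow> real \<Rightarrow> (complex \<Rightarrow> complex) \<Rightarrow> bool" where
  "scorer_solution n c y \<longleftrightarrow>
     (\<forall>j<n - 1. (deriv ^^ j) y holomorphic_on UNIV) \<and>
     (\<forall>x. (deriv ^^ (n - 1)) y x + of_real c * x * y x = 1)"

definition f1_integrand :: "nat \<Rightarrow> real \<Rightarrow> complex \<Rightarrow> real \<Rightarrow> complex" where
  "f1_integrand n c x w =
     exp (of_real (- ((- c) ^ (n - 1) * (w ^ n / real n))) - of_real (c * w) * x)"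

definition g1_integrand :: "nat \<Rightarrow> real \<Rightarrow> nat \<Rightarrow> complex \<Rightarrow> real \<Rightarrow> complex" where
  "g1_integrand n c k x w =
     (let a = cos (2 * real k * pi / real n); b = sin (2 * real k * pi / real n) in
        exp (of_real (- ((- c) ^ (n - 1) * (w ^ n / real n))) - of_real (c * w) * x * of_real a) *
        cos (of_real (c * w) * x * of_real b - of_real (2 * real k * pi / real n)))"

definition f2_integrand :: "nat \<Rightarrow> real \<Rightarrow> complex \<Rightarrow> real \<Rightarrow> complex" where
  "f2_integrand n c x w =
     exp (of_real ((- c) ^ (n - 1) * (w ^ n / real n))
          - of_real (c * w) * x * exp (\<i> * of_real (pi / real n)))"

definition g2_integrand :: "nat \<Rightarrow> real \<Rightarrow> nat \<Rightarrow> complex \<Rightarrow> real \<Rightarrow> complex" where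
  "g2_integrand n c k x w =
     (let a = cos ((2 * real k + 1) * pi / real n); b = sin ((2 * real k + 1) * pi / real n) in
        exp (of_real ((- c) ^ (n - 1) * (w ^ n / real n)) - of_real (c * w) * x * of_real a) *
        cos (of_real (c * w) * x * of_real b - of_real ((2 * real k + 1) / real n * pi)))"

definition f1 :: "nat \<Rightarrow> real \<Rightarrow> complex \<Rightarrow> complex" where
  "f1 n c x = (LBINT w:{0..}. f1_integrand n c x w)"

definition g1 :: "nat \<Rightarrow> real \<Rightarrow> nat \<Rightarrow> complex \<Rightarrow> complex" where
  "g1 n c k x = (LBINT w:{0..}. g1_integrand n c k x w)"

definition f2 :: "nat \<Rightarrow> real \<Rightarrow> complex \<Rightarrow> complex" where
  "f2 n c x = exp (\<i> * of_real (pi / real n)) * (LBINT w:{0..}. f2_integrand n c x w)"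

definition g2 :: "nat \<Rightarrow> real \<Rightarrow> nat \<Rightarrow> complex \<Rightarrow> complex" where
  "g2 n c k x = (LBINT w:{0..}. g2_integrand n c k x w)"

text \<open>The Lebesgue integral of a non-integrable function is \<open>0\<close> by convention; this predicate
  records that the integral over \<open>[0,\<infinity>)\<close> converges for every \<open>x\<close>.\<close>

definition integral_defined :: "(complex \<Rightarrow> real \<Rightarrow> complex) \<Rightarrow> bool" where
  "integral_defined F \<longleftrightarrow> (\<forall>x. set_integrable lborel {0..} (F x))"

end

theory Submission
  imports Defs "HOL-Probability.Sinc_Integral"
begin

text \<open>Put \<open>M\<^sub>m(z) = \<integral> w\<^sup>m exp (- A w\<^sup>n - w z) dw\<close> over \<open>[0,\<infinity>)\<close>. These are entire with
  \<open>M\<^sub>m' = - M\<^bsub>m+1\<^esub>\<close>, and integrating the \<open>w\<close>-derivative of \<open>exp (- A w\<^sup>n - w z)\<close> gives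
  \<open>n A M\<^bsub>n-1\<^esub>(z) + z M\<^sub>0(z) = 1\<close>. Hence \<open>\<zeta> M\<^sub>0(c \<zeta> x)\<close> solves the equation as soon as
  \<open>\<zeta>\<^sup>n (- c)\<^bsup>n-1\<^esup> = n A\<close>. For \<open>\<bar>\<zeta>\<bar> = 1\<close> this forces \<open>n A = \<bar>c\<bar>\<^bsup>n-1\<^esup>\<close>, so that \<open>\<zeta>\<close> is an
  \<open>n\<close>-th root of \<open>1\<close> in case (1) and of \<open>-1\<close> in case (2); \<open>f\<close> is one such solution and
  \<open>g\<^sub>k\<close> is the average of those belonging to a conjugate pair \<open>\<zeta>\<close>, \<open>\<zeta>'\<close>.\<close>

section \<open>Growth bounds and integrability on the half-line\<close>

lemma power_le_fact_exp:
  fixes w :: real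
  assumes "0 \<le> w"
  shows "w ^ m \<le> fact m * exp w"
proof -
  have "summable (\<lambda>k. w ^ k /\<^sub>R fact k)" "(\<Sum>k. w ^ k /\<^sub>R fact k) = exp w"
    using exp_converges[of w] by (auto simp: sums_iff)
  then have "(\<Sum>k\<in>{m}. w ^ k /\<^sub>R fact k) \<le> exp w"
    using assms sum_le_suminf[of "\<lambda>k. w ^ k /\<^sub>R fact k" "{m}"] by auto
  then show ?thesis
    by (simp add: field_simps)
qed

text \<open>For \<open>w \<le> 1\<close> the linear term is at most \<open>S\<close>. For
  \<open>w > 1\<close> the power dominates \<open>w\<^sup>2\<close>, and completing the square
  leaves \<open>S\<^sup>2 / (4 * A)\<close>. The sum of both bounds serves in either case.\<close>

lemma superlinear_exponent_bound:
  fixes A S w :: real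
  assumes "n \<ge> 2" "A > 0" "S \<ge> 0" "w \<ge> 0"
  shows "S * w - A * w ^ n \<le> S + S\<^sup>2 / (4 * A)"
proof (cases "w \<le> 1")
  case True
  have "S * w \<le> S" "0 \<le> A * w ^ n" "0 \<le> S\<^sup>2 / (4 * A)"
    using assms True by (auto simp: mult_left_le)
  then show ?thesis by linarith
next
  case False
  then have "w\<^sup>2 \<le> w ^ n"
    using assms by (intro power_increasing) auto
  then have "A * w\<^sup>2 \<le> A * w ^ n"
    using assms by simp
  moreover have "S * w - A * w\<^sup>2 = S\<^sup>2 / (4 * A) - A * (w - S / (2 * A))\<^sup>2"
    using assms by (simp add: field_simps power2_eq_square)
  moreover have "0 \<le> A * (w - S / (2 * A))\<^sup>2"
    using assms by simp
  ultimately show ?thesis using assms by linarith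
qed

text \<open>Supplies both the integrable majorant for the moments and the decay at infinity of the
  boundary term in \<open>moment_identity\<close>.\<close>

lemma moment_integrand_bound:
  fixes A R :: real
  assumes "n \<ge> 2" "A > 0"
  obtains C where "\<And>w. w \<ge> 0 \<Longrightarrow> w ^ m * exp (R * w - A * w ^ n) \<le> C * exp (- w)"
proof
  \<comment> \<open>Of the extra 2, one unit absorbs the \<open>exp w\<close> that bounds
    \<open>w ^ m\<close>; the other leaves the factor \<open>exp (- w)\<close>.\<close>
  define S where "S = \<bar>R\<bar> + 2"
  fix w :: real assume w: "w \<ge> 0"
  have "R * w \<le> \<bar>R\<bar> * w"
    using w by (intro mult_right_mono) auto
  then have "R * w + 2 * w \<le> S * w"
    unfolding S_def by (simp add: algebra_simps)
  moreover have "S * w - A * w ^ n \<le> S + S\<^sup>2 / (4 * A)"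
    by (rule superlinear_exponent_bound) (use assms w in \<open>auto simp: S_def\<close>)
  ultimately have *: "exp (w + (R * w - A * w ^ n)) \<le> exp (S + S\<^sup>2 / (4 * A) - w)"
    by simp
  have "w ^ m * exp (R * w - A * w ^ n) \<le> fact m * exp w * exp (R * w - A * w ^ n)"
    using power_le_fact_exp[OF w] by (intro mult_right_mono) auto
  also have "\<dots> = fact m * exp (w + (R * w - A * w ^ n))"
    by (simp add: exp_add)
  also have "\<dots> \<le> fact m * exp (S + S\<^sup>2 / (4 * A) - w)"
    using * by (intro mult_left_mono) auto
  also have "\<dots> = fact m * exp (S + S\<^sup>2 / (4 * A)) * exp (- w)"
    by (simp flip: exp_add)
  finally show "w ^ m * exp (R * w - A * w ^ n)
      \<le> (fact m * exp (\<bar>R\<bar> + 2 + (\<bar>R\<bar> + 2)\<^sup>2 / (4 * A))) * exp (- w)"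
    by (simp add: S_def)
qed

lemma set_integrable_moment_real:
  fixes A R :: real
  assumes "n \<ge> 2" "A > 0"
  shows "set_integrable lborel {0..} (\<lambda>w. w ^ m * exp (R * w - A * w ^ n))"
proof -
  obtain C where C: "\<And>w. w \<ge> 0 \<Longrightarrow> w ^ m * exp (R * w - A * w ^ n) \<le> C * exp (- w)"
    using moment_integrand_bound[OF assms] by blast
  have "set_integrable lborel {0<..} (\<lambda>w::real. exp (- w))"
    using integrable_I0i_exp_mscale[of 1] by simp
  then have "set_integrable lborel {0..} (\<lambda>w::real. exp (- w))"
    by (subst set_integrable_discrete_difference[where X = "{0}" and B = "{0<..}"]) auto
  then have "set_integrable lborel {0..} (\<lambda>w. C * exp (- w))"
    by simp
  then show ?thesis
    by (rule set_integrable_bound) (use C in \<open>force simp: set_borel_measurable_def intro!: AE_I2\<close>)+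
qed

section \<open>Moment integrals: differentiation in the parameter and the integrated
  identity\<close>

definition moment_integrand :: "nat \<Rightarrow> real \<Rightarrow> nat \<Rightarrow> complex \<Rightarrow> real \<Rightarrow> complex" where
  "moment_integrand n A m z w = of_real (w ^ m) * exp (- of_real (A * w ^ n) - of_real w * z)"

definition moment :: "nat \<Rightarrow> real \<Rightarrow> nat \<Rightarrow> complex \<Rightarrow> complex" where
  "moment n A m z = (LBINT w:{0..}. moment_integrand n A m z w)"

lemma norm_moment_integrand:
  "w \<ge> 0 \<Longrightarrow> norm (moment_integrand n A m z w) = w ^ m * exp (- Re z * w - A * w ^ n)"
  by (simp add: moment_integrand_def norm_mult norm_power algebra_simps flip: of_real_power)

lemma moment_integrand_measurable [measurable]:
  "moment_integrand n A m z \<in> borel_measurable borel"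
  unfolding moment_integrand_def[abs_def]
  by (intro borel_measurable_continuous_onI continuous_intros)

lemma set_integrable_moment_integrand:
  assumes "n \<ge> 2" "A > 0"
  shows "set_integrable lborel {0..} (moment_integrand n A m z)"
  using set_integrable_moment_real[OF assms, of m "- Re z"]
  by (rule set_integrable_bound)
    (auto simp: set_borel_measurable_def norm_moment_integrand intro!: AE_I2)

lemma norm_exp_remainder_le:
  fixes u :: complex
  shows "norm (exp u - (1 + u)) \<le> exp (norm u) * (norm u)\<^sup>2"
proof -
  have "norm (exp u - (1 + u)) \<le> exp \<bar>Re u\<bar> * (norm u)\<^sup>2"
    using Taylor_exp[of u 1] by (simp add: numeral_2_eq_2)
  also have "\<dots> \<le> exp (norm u) * (norm u)\<^sup>2"
    using abs_Re_le_cmod[of u] by (intro mult_right_mono) auto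
  finally show ?thesis .
qed

text \<open>With \<open>u = - w * h\<close> the left side factors through
  \<open>exp u - (1 + u)\<close>. The restriction \<open>norm h \<le> 1\<close> bounds
  \<open>exp (norm u)\<close> by \<open>exp w\<close>, so \<open>h\<close> enters the majorant only
  through \<open>(norm h)\<^sup>2\<close>.\<close>

lemma moment_integrand_remainder_le:
  assumes w: "w \<ge> 0" and h: "norm h \<le> 1"
  shows "norm (moment_integrand n A m (z + h) w - moment_integrand n A m z w
             + h * moment_integrand n A (Suc m) z w)
       \<le> (norm h)\<^sup>2 * (w ^ (m + 2) * exp ((1 - Re z) * w - A * w ^ n))"
proof -
  define u where "u = - (of_real w * h)"
  have nu: "norm u = w * norm h" using w by (simp add: u_def norm_mult)
  have "moment_integrand n A m (z + h) w - moment_integrand n A m z w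
             + h * moment_integrand n A (Suc m) z w
      = moment_integrand n A m z w * (exp u - (1 + u))"
  proof -
    have "- of_real (A * w ^ n) - of_real w * (z + h)
        = (- of_real (A * w ^ n) - of_real w * z) + u"
      by (simp add: u_def algebra_simps)
    then have "exp (- of_real (A * w ^ n) - of_real w * (z + h))
        = exp (- of_real (A * w ^ n) - of_real w * z) * exp u"
      by (simp only: exp_add)
    then show ?thesis
      by (simp add: moment_integrand_def u_def algebra_simps)
  qed
  then have "norm (moment_integrand n A m (z + h) w - moment_integrand n A m z w
             + h * moment_integrand n A (Suc m) z w)
      = w ^ m * exp (- Re z * w - A * w ^ n) * norm (exp u - (1 + u))"
    using w by (simp add: norm_mult norm_moment_integrand)
  also have "\<dots> \<le> w ^ m * exp (- Re z * w - A * w ^ n) * (exp w * (w * norm h)\<^sup>2)"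
  proof (intro mult_left_mono)
    have "w * norm h \<le> w" using w h by (simp add: mult_left_le)
    then have "exp (norm u) * (norm u)\<^sup>2 \<le> exp w * (w * norm h)\<^sup>2"
      unfolding nu by (intro mult_right_mono) auto
    then show "norm (exp u - (1 + u)) \<le> exp w * (w * norm h)\<^sup>2"
      using norm_exp_remainder_le[of u] by linarith
  qed (use w in auto)
  also have "\<dots> = (norm h)\<^sup>2 * (w ^ (m + 2) * (exp w * exp (- Re z * w - A * w ^ n)))"
    by (simp add: power_add power_mult_distrib power2_eq_square)
  also have "exp w * exp (- Re z * w - A * w ^ n) = exp ((1 - Re z) * w - A * w ^ n)"
    by (simp add: algebra_simps flip: exp_add)
  finally show ?thesis .
qed

text \<open>Differentiation under the integral sign by direct estimate: the integrated remainder is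
  at most \<open>(norm h)\<^sup>2 * K\<close>, so the difference quotient is off by at most
  \<open>norm h * K\<close>.\<close>

lemma moment_has_field_derivative:
  assumes "n \<ge> 2" "A > 0"
  shows "(moment n A m has_field_derivative - moment n A (Suc m) z) (at z)"
proof -
  define K where "K = (LBINT w:{0..}. w ^ (m + 2) * exp ((1 - Re z) * w - A * w ^ n))"
  note int = set_integrable_moment_integrand[OF assms]
  have bound: "norm (moment n A m (z + h) - moment n A m z + h * moment n A (Suc m) z)
      \<le> (norm h)\<^sup>2 * K" if h: "norm h \<le> 1" for h
  proof -
    let ?r = "\<lambda>w. moment_integrand n A m (z + h) w - moment_integrand n A m z w
                + h * moment_integrand n A (Suc m) z w"
    have ir: "set_integrable lborel {0..} ?r"
      by (intro set_integral_add set_integral_diff set_integrable_mult_right int)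
    have "moment n A m (z + h) - moment n A m z + h * moment n A (Suc m) z
        = (LBINT w:{0..}. ?r w)"
      unfolding moment_def
      by (simp add: int set_integral_add set_integral_diff)
    also have "norm \<dots> \<le> (LBINT w:{0..}. norm (?r w))"
      using ir by (rule set_integral_norm_bound)
    also have "\<dots> \<le> (LBINT w:{0..}.
        (norm h)\<^sup>2 * (w ^ (m + 2) * exp ((1 - Re z) * w - A * w ^ n)))"
      using ir h set_integrable_moment_real[OF assms, of "m + 2" "1 - Re z"]
      by (intro set_integral_mono set_integrable_norm set_integrable_mult_right
           moment_integrand_remainder_le) auto
    also have "\<dots> = (norm h)\<^sup>2 * K"
      by (simp add: K_def)
    finally show ?thesis .
  qed
  have "(\<lambda>h. (moment n A m (z + h) - moment n A m z) / h - - moment n A (Suc m) z)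
      \<midarrow>0\<rightarrow> 0"
  proof (rule Lim_null_comparison)
    show "((\<lambda>h. norm h * K) \<longlongrightarrow> 0) (at (0::complex))"
      by (auto intro!: tendsto_eq_intros)
    have "\<forall>\<^sub>F h in at (0::complex). h \<in> ball 0 1 - {0}"
      by (rule eventually_at_in_open) auto
    then show "\<forall>\<^sub>F h in at 0. norm ((moment n A m (z + h) - moment n A m z) / h
        - - moment n A (Suc m) z) \<le> norm h * K"
    proof eventually_elim
      case (elim h)
      then have "h \<noteq> 0" "norm h \<le> 1" by auto
      have "(moment n A m (z + h) - moment n A m z) / h - - moment n A (Suc m) z
          = (moment n A m (z + h) - moment n A m z + h * moment n A (Suc m) z) / h"
        using \<open>h \<noteq> 0\<close> by (simp add: field_simps)
      then show ?case
        using bound[OF \<open>norm h \<le> 1\<close>] \<open>h \<noteq> 0\<close>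
        by (simp add: norm_divide field_simps power2_eq_square)
    qed
  qed
  then show ?thesis
    unfolding DERIV_def by (simp only: LIM_zero_iff)
qed

lemma moment_holomorphic:
  assumes "n \<ge> 2" "A > 0"
  shows "moment n A m holomorphic_on UNIV"
  using moment_has_field_derivative[OF assms] by (auto simp: holomorphic_on_open)

lemma higher_deriv_moment:
  assumes "n \<ge> 2" "A > 0"
  shows "(deriv ^^ j) (moment n A 0) = (\<lambda>z. (- 1) ^ j * moment n A j z)"
proof (induction j)
  case (Suc j)
  have "deriv (\<lambda>z. (- 1) ^ j * moment n A j z) z = (- 1) ^ Suc j * moment n A (Suc j) z" for z
    by (rule DERIV_imp_deriv)
      (auto intro!: derivative_eq_intros moment_has_field_derivative[OF assms])
  then show ?case
    using Suc by auto
qed auto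

lemma moment_identity:
  assumes n: "n \<ge> 2" and A: "A > 0"
  shows "of_real (real n * A) * moment n A (n - 1) z + z * moment n A 0 z = 1"
proof -
  define E where "E = (\<lambda>w::real. moment_integrand n A 0 z w)"
  define E' where "E' = (\<lambda>w::real. (- of_real (real n * A)) * moment_integrand n A (n - 1) z w
    + (- z) * moment_integrand n A 0 z w)"
  note int = set_integrable_moment_integrand[OF assms]
  have intE': "set_integrable lborel {0..} E'"
    unfolding E'_def by (intro set_integral_add set_integrable_mult_right int)
  have der: "(E has_vector_derivative E' w) (at w)" for w
  proof -
    \<comment> \<open>The derivative is computed in a complex variable \<open>v\<close> and then
      restricted to the real line.\<close>
    have "((\<lambda>v. exp (- (of_real A * v ^ n) - v * z)) has_field_derivative
        E' w) (at (of_real w))"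
      unfolding E'_def moment_integrand_def
      by (auto intro!: derivative_eq_intros simp: algebra_simps)
    from has_vector_derivative_real_field[OF this] show ?thesis
      by (simp add: E_def moment_integrand_def)
  qed
  obtain C where C: "\<And>w. w \<ge> 0 \<Longrightarrow> w ^ 0 * exp (- Re z * w - A * w ^ n) \<le> C * exp (- w)"
    using moment_integrand_bound[OF assms] by blast
  have lim: "(E \<longlongrightarrow> 0) at_top"
  proof (rule Lim_null_comparison)
    show "((\<lambda>w. C * exp (- w)) \<longlongrightarrow> 0) at_top"
      by real_asymp
    show "\<forall>\<^sub>F w in at_top. norm (E w) \<le> C * exp (- w)"
      using eventually_ge_at_top[of 0]
      by eventually_elim (use C in \<open>simp add: E_def norm_moment_integrand\<close>)
  qed
  have lim0: "(E \<longlongrightarrow> 1) (at_right 0)"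
  proof -
    have "isCont E 0"
      using der by (blast intro: has_vector_derivative_continuous)
    then have "(E \<longlongrightarrow> E 0) (at_right 0)"
      by (simp add: isCont_def filterlim_at_split)
    \<comment> \<open>\<open>E 0 = 1\<close> relies on \<open>0 ^ n = 0\<close>, hence on
      \<open>n\<close> being positive.\<close>
    then show ?thesis
      using n by (simp add: E_def moment_integrand_def power_0_left)
  qed
  \<comment> \<open>Limit of \<open>E\<close> at infinity minus limit at 0. The interval integral
    runs over the open half-line; the endpoint is a null set and is restored below.\<close>
  have "(LBINT w=0..\<infinity>. E' w) = 0 - 1"
  proof (rule interval_integral_FTC_integrable)
    show "isCont E' w" for w
      unfolding E'_def moment_integrand_def by (intro continuous_intros)
    show "set_integrable lborel (einterval 0 \<infinity>) E'"
      using intE' by (rule set_integrable_subset) (auto simp: einterval_def zero_ereal_def)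
    show "((E \<circ> real_of_ereal) \<longlongrightarrow> 1) (at_right 0)"
      using lim0 by (simp add: zero_ereal_def ereal_tendsto_simps)
    show "((E \<circ> real_of_ereal) \<longlongrightarrow> 0) (at_left \<infinity>)"
      using lim by (simp add: ereal_tendsto_simps)
  qed (use der in auto)
  also have "(LBINT w=0..\<infinity>. E' w) = (LBINT w:{0<..}. E' w)"
    by (rule interval_lebesgue_integral_0_infty)
  also have "\<dots> = (LBINT w:{0..}. E' w)"
    by (rule set_integral_discrete_difference[where X = "{0}"]) auto
  also have "\<dots> = (LBINT w:{0..}. (- of_real (real n * A)) * moment_integrand n A (n - 1) z w)
      + (LBINT w:{0..}. (- z) * moment_integrand n A 0 z w)"
    unfolding E'_def by (intro set_integral_add set_integrable_mult_right int)
  also have "\<dots> = (- of_real (real n * A)) * moment n A (n - 1) z + (- z) * moment n A 0 z"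
    by (simp only: set_integral_mult_right moment_def)
  finally show ?thesis
    by (simp add: algebra_simps)
qed

section \<open>Solutions attached to the roots\<close>

text \<open>Division by \<open>n\<close> gives the exponent the form \<open>- A * w ^ n / n\<close>
  of the given integrals. If \<open>\<zeta> ^ n * (- c) ^ (n - 1) = A\<close>, substituting
  \<open>s = \<zeta> * w\<close> turns this into the integral of
  \<open>exp (- (- c) ^ (n - 1) * s ^ n / n - c * s * x)\<close> along the ray from 0 through
  \<open>\<zeta>\<close>.\<close>

definition scorer_branch :: "nat \<Rightarrow> real \<Rightarrow> real \<Rightarrow> complex \<Rightarrow> complex \<Rightarrow> complex" where
  "scorer_branch n A c \<zeta> x = \<zeta> * moment n (A / real n) 0 (of_real c * \<zeta> * x)"

text \<open>The chain rule puts \<open>\<zeta> ^ n * (- c) ^ (n - 1) = A\<close> in front of the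
  moment of order \<open>n - 1\<close>. The equation is then \<open>moment_identity\<close> at
  \<open>z = c * \<zeta> * x\<close>.\<close>

lemma scorer_branch_solution:
  assumes n: "n \<ge> 2" and A: "A > 0"
    and root: "\<zeta> ^ n * of_real ((- c) ^ (n - 1)) = of_real A"
  shows "scorer_solution n c (scorer_branch n A c \<zeta>)"
proof -
  have A': "A / real n > 0" using n A by simp
  have hol: "(\<lambda>x. moment n (A / real n) 0 (of_real c * \<zeta> * x)) holomorphic_on UNIV"
    using holomorphic_on_compose_gen[OF _ moment_holomorphic[OF n A'],
        of "\<lambda>x. of_real c * \<zeta> * x" UNIV 0]
    by (auto simp: o_def intro!: holomorphic_intros)
  have *: "(deriv ^^ (n - 1)) (scorer_branch n A c \<zeta>) x
      = \<zeta> * ((of_real c * \<zeta>) ^ (n - 1) * ((- 1) ^ (n - 1)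
          * moment n (A / real n) (n - 1) (of_real c * \<zeta> * x)))" for x
    unfolding scorer_branch_def[abs_def]
    by (simp add: higher_deriv_cmult[OF hol] higher_deriv_moment[OF n A']
        higher_deriv_compose_linear[OF moment_holomorphic[OF n A'], of UNIV])
  have "\<zeta> * ((of_real c * \<zeta>) ^ (n - 1) * (- 1) ^ (n - 1))
      = \<zeta> ^ n * of_real ((- c) ^ (n - 1))"
    using n by (cases n) (simp_all add: power_mult_distrib[symmetric] mult_ac)
  then have coeff: "\<zeta> * ((of_real c * \<zeta>) ^ (n - 1) * ((- 1) ^ (n - 1) * M)) = of_real A * M"
    for M
    using root by (metis mult.assoc)
  have "(deriv ^^ (n - 1)) (scorer_branch n A c \<zeta>) x
      + of_real c * x * scorer_branch n A c \<zeta> x = 1" for x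
    using moment_identity[OF n A', of "of_real c * \<zeta> * x"] n
    unfolding * coeff by (simp add: scorer_branch_def mult_ac)
  moreover have "scorer_branch n A c \<zeta> holomorphic_on UNIV"
    unfolding scorer_branch_def[abs_def] by (intro holomorphic_intros hol)
  ultimately show ?thesis
    by (auto simp: scorer_solution_def intro: holomorphic_higher_deriv)
qed

text \<open>The equation is linear but inhomogeneous, so it is affine combinations that preserve
  solutions; the average is the one that produces a cosine.\<close>

lemma scorer_solution_average:
  assumes n: "n \<ge> 2" and y: "scorer_solution n c y" "scorer_solution n c z"
  shows "scorer_solution n c (\<lambda>x. (y x + z x) / 2)"
proof -
  have hol: "y holomorphic_on UNIV" "z holomorphic_on UNIV"
  proof -
    \<comment> \<open>Holomorphy is demanded only for orders below \<open>n - 1\<close>; since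
      \<open>n \<ge> 2\<close>, order 0 is among them.\<close>
    have "0 < n - 1" using n by simp
    then have "(deriv ^^ 0) y holomorphic_on UNIV" "(deriv ^^ 0) z holomorphic_on UNIV"
      using y unfolding scorer_solution_def by blast+
    then show "y holomorphic_on UNIV" "z holomorphic_on UNIV" by simp_all
  qed
  have hol2: "(\<lambda>x. y x + z x) holomorphic_on UNIV"
    by (intro holomorphic_intros hol)
  have d: "(deriv ^^ j) (\<lambda>x. (1 / 2) * (y x + z x)) x
      = (1 / 2) * ((deriv ^^ j) y x + (deriv ^^ j) z x)" for j x
    using higher_deriv_cmult[OF hol2, of x j "1/2"] higher_deriv_add[OF hol, of x j] by simp
  have "(\<lambda>x. (1 / 2) * (y x + z x)) holomorphic_on UNIV"
    by (intro holomorphic_intros hol)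
  moreover have "(deriv ^^ (n - 1)) (\<lambda>x. (1 / 2) * (y x + z x)) x
      + of_real c * x * ((1 / 2) * (y x + z x)) = 1" for x
  proof -
    have "(deriv ^^ (n - 1)) y x + of_real c * x * y x = 1"
      "(deriv ^^ (n - 1)) z x + of_real c * x * z x = 1"
      using y by (auto simp: scorer_solution_def)
    moreover have "1 / 2 * (p + q) + e * (1 / 2 * (u + v)) = 1"
      if "p + e * u = 1" "q + e * v = 1" for p q e u v :: complex
    proof -
      have "p = 1 - e * u" "q = 1 - e * v"
        using that by (simp_all add: eq_diff_eq)
      then show ?thesis
        by (simp only:) (simp add: field_simps)
    qed
    ultimately show ?thesis unfolding d by blast
  qed
  ultimately have "scorer_solution n c (\<lambda>x. (1 / 2) * (y x + z x))"
    by (auto simp: scorer_solution_def intro: holomorphic_higher_deriv)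
  then show ?thesis by simp
qed

section \<open>From branches to the cosine and exponential integrals\<close>

text \<open>The two terms on the right equal \<open>exp s * exp (- (\<i> * v))\<close> and
  \<open>exp s * exp (\<i> * v)\<close>, and Euler's formula gives \<open>exp s * cos v\<close>. As
  \<open>x\<close> is complex, they need not be conjugate, so the average is not simply a real
  part.\<close>

lemma cis_average_moment_integrand:
  fixes A c t w :: real and x :: complex
  shows "exp (- of_real (A * w ^ n) - of_real (c * w) * x * of_real (cos t))
           * cos (of_real (c * w) * x * of_real (sin t) - of_real t)
       = (cis t * moment_integrand n A 0 (of_real c * cis t * x) w
          + cis (- t) * moment_integrand n A 0 (of_real c * cis (- t) * x) w) / 2"
proof -
  define v where "v = of_real (c * w) * x * of_real (sin t) - complex_of_real t"
  define s where "s = - of_real (A * w ^ n) - of_real (c * w) * x * of_real (cos t)"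
  have cis: "cis t = of_real (cos t) + \<i> * of_real (sin t)"
    "cis (- t) = of_real (cos t) - \<i> * of_real (sin t)"
    by (simp_all add: complex_eq_iff)
  have "cis t * moment_integrand n A 0 (of_real c * cis t * x) w
      = exp (\<i> * of_real t + (- of_real (A * w ^ n) - of_real w * (of_real c * cis t * x)))"
    by (simp add: moment_integrand_def cis_conv_exp exp_add)
  also have "\<i> * of_real t + (- of_real (A * w ^ n) - of_real w * (of_real c * cis t * x))
      = s + - (\<i> * v)"
    by (simp add: s_def v_def cis(1) algebra_simps)
  finally have 1: "cis t * moment_integrand n A 0 (of_real c * cis t * x) w
      = exp s * exp (- (\<i> * v))"
    by (simp add: exp_add exp_minus exp_diff field_simps)
  have "cis (- t) * moment_integrand n A 0 (of_real c * cis (- t) * x) w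
      = exp (- (\<i> * of_real t) + (- of_real (A * w ^ n) - of_real w * (of_real c * cis (- t) * x)))"
    by (simp only: moment_integrand_def cis_conv_exp exp_add) simp
  also have "- (\<i> * of_real t) + (- of_real (A * w ^ n) - of_real w * (of_real c * cis (- t) * x))
      = s + \<i> * v"
    by (simp add: s_def v_def cis(2) algebra_simps)
  finally have 2: "cis (- t) * moment_integrand n A 0 (of_real c * cis (- t) * x) w
      = exp s * exp (\<i> * v)"
    by (simp add: exp_add)
  show ?thesis
    unfolding 1 2 s_def[symmetric] v_def[symmetric] by (simp add: cos_exp_eq field_simps)
qed

text \<open>The integral is the average of the branches at \<open>cis t\<close> and
  \<open>cis (- t)\<close>. Leaving \<open>t\<close> and \<open>A\<close> free lets it serve both
  families \<open>g1\<close> and \<open>g2\<close>.\<close>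

lemma cosine_integral_solution:
  fixes A c t :: real
  assumes n: "n \<ge> 2" and A: "A > 0"
    and root: "cis (real n * t) * of_real ((- c) ^ (n - 1)) = of_real A"
    and F: "\<And>x w. F x w = exp (- of_real (A * (w ^ n / real n))
              - of_real (c * w) * x * of_real (cos t))
           * cos (of_real (c * w) * x * of_real (sin t) - of_real t)"
  shows "integral_defined F \<and> scorer_solution n c (\<lambda>x. LBINT w:{0..}. F x w)"
proof -
  have A': "A / real n > 0" using n A by simp
  note int = set_integrable_moment_integrand[OF n A', of 0]
  have F_eq: "F x = (\<lambda>w. (cis t * moment_integrand n (A / real n) 0 (of_real c * cis t * x) w
     + cis (- t) * moment_integrand n (A / real n) 0 (of_real c * cis (- t) * x) w) / 2)" for x
    using cis_average_moment_integrand[of "A / real n" _ n c x t] by (simp add: F fun_eq_iff)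
  have "integral_defined F"
    unfolding integral_defined_def F_eq
    by (intro allI set_integrable_divide set_integral_add set_integrable_mult_right int)
  moreover have "(\<lambda>x. LBINT w:{0..}. F x w)
      = (\<lambda>x. (scorer_branch n A c (cis t) x + scorer_branch n A c (cis (- t)) x) / 2)"
    unfolding F_eq scorer_branch_def moment_def
    by (simp add: int set_integral_add set_integrable_mult_right)
  \<comment> \<open>Conjugating \<open>root\<close>, whose other terms are real, gives the root
    condition at the opposite angle.\<close>
  moreover have "cis (- (real n * t)) * of_real ((- c) ^ (n - 1)) = of_real A"
    using arg_cong[OF root, of cnj] by (simp add: cis_cnj)
  then have "scorer_solution n c (scorer_branch n A c (cis (- t)))"
    by (intro scorer_branch_solution n A) (simp add: Complex.DeMoivre)
  moreover have "scorer_solution n c (scorer_branch n A c (cis t))"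
    using root by (intro scorer_branch_solution n A) (simp add: Complex.DeMoivre)
  ultimately show ?thesis
    using scorer_solution_average[OF n] by simp
qed

text \<open>A single branch: \<open>f1\<close> arises from the root 1, \<open>f2\<close> from
  \<open>exp (\<i> * of_real (pi / real n))\<close>.\<close>

lemma exponential_integral_solution:
  fixes A c :: real
  assumes n: "n \<ge> 2" and A: "A > 0"
    and root: "\<zeta> ^ n * of_real ((- c) ^ (n - 1)) = of_real A"
    and F: "\<And>x w. F x w = exp (- of_real (A * (w ^ n / real n)) - of_real (c * w) * x * \<zeta>)"
  shows "integral_defined F \<and> scorer_solution n c (\<lambda>x. \<zeta> * (LBINT w:{0..}. F x w))"
proof -
  have A': "A / real n > 0" using n A by simp
  have F_eq: "F x = moment_integrand n (A / real n) 0 (of_real c * \<zeta> * x)" for x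
    by (simp add: F moment_integrand_def fun_eq_iff mult_ac)
  have "integral_defined F"
    unfolding integral_defined_def F_eq using set_integrable_moment_integrand[OF n A'] by blast
  moreover have "(\<lambda>x. \<zeta> * (LBINT w:{0..}. F x w)) = scorer_branch n A c \<zeta>"
    by (simp add: F_eq scorer_branch_def moment_def fun_eq_iff)
  ultimately show ?thesis
    using scorer_branch_solution[OF n A root] by simp
qed

section \<open>The two sign cases\<close>

theorem mainTheorem6:
  fixes n :: nat and c :: real
  assumes "n \<ge> 2" and "c \<noteq> 0"
  shows
    "(odd n \<or> (even n \<and> c < 0) \<longrightarrow>
        (integral_defined (f1_integrand n c) \<and> scorer_solution n c (f1 n c)) \<and>
        (\<forall>k::nat. 1 \<le> k \<and> real k \<le> real n / 2 \<longrightarrow>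
           integral_defined (g1_integrand n c k) \<and> scorer_solution n c (g1 n c k))) \<and>
     (even n \<and> c > 0 \<longrightarrow>
        (integral_defined (f2_integrand n c) \<and> scorer_solution n c (f2 n c)) \<and>
        (\<forall>k\<in>{0..n div 2 - 1}.
           integral_defined (g2_integrand n c k) \<and> scorer_solution n c (g2 n c k)))"
proof (intro conjI[of "_ \<longrightarrow> _"] impI)
  assume "odd n \<or> (even n \<and> c < 0)"
  \<comment> \<open>Either \<open>n - 1\<close> is even and \<open>c\<close> is nonzero, or the base
    \<open>- c\<close> is positive.\<close>
  then have A: "(- c) ^ (n - 1) > 0"
    using assms by (auto simp: zero_less_power_eq)
  have "integral_defined (f1_integrand n c) \<and> scorer_solution n c (f1 n c)"
  proof -
    have "integral_defined (f1_integrand n c)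
        \<and> scorer_solution n c (\<lambda>x. 1 * (LBINT w:{0..}. f1_integrand n c x w))"
      by (rule exponential_integral_solution[OF assms(1) A]) (simp_all add: f1_integrand_def)
    then show ?thesis
      by (simp add: f1_def[abs_def])
  qed
  moreover have "integral_defined (g1_integrand n c k) \<and> scorer_solution n c (g1 n c k)" for k
    unfolding g1_def[abs_def]
  \<comment> \<open>Here \<open>n * t\<close> is a multiple of \<open>2 * pi\<close>, so
    \<open>cis t\<close> is an \<open>n\<close>-th root of 1.\<close>
  proof (rule cosine_integral_solution[OF assms(1) A, where t = "2 * real k * pi / real n"])
    have "real n * (2 * real k * pi / real n) = 2 * pi * real k"
      using assms(1) by simp
    then have "cis (real n * (2 * real k * pi / real n)) = 1"
      by (metis Ints_of_nat cis_multiple_2pi)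
    then show "cis (real n * (2 * real k * pi / real n)) * of_real ((- c) ^ (n - 1))
        = of_real ((- c) ^ (n - 1))"
      by simp
  qed (simp add: g1_integrand_def Let_def)
  ultimately show "(integral_defined (f1_integrand n c) \<and> scorer_solution n c (f1 n c)) \<and>
        (\<forall>k::nat. 1 \<le> k \<and> real k \<le> real n / 2 \<longrightarrow>
           integral_defined (g1_integrand n c k) \<and> scorer_solution n c (g1 n c k))"
    by blast
next
  assume "even n \<and> c > 0"
  \<comment> \<open>An odd power of the negative number \<open>- c\<close>: the sign flips, and the
    roots of -1 below compensate for it.\<close>
  then have A: "- ((- c) ^ (n - 1)) > 0"
    using assms by (auto simp: power_less_zero_eq)
  have "integral_defined (f2_integrand n c) \<and> scorer_solution n c (f2 n c)"
    unfolding f2_def[abs_def]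
  proof (rule exponential_integral_solution[OF assms(1) A])
    have "exp (\<i> * of_real (pi / real n)) ^ n = - 1"
      using assms(1) by (simp add: cis_conv_exp[symmetric] Complex.DeMoivre del: of_real_divide)
    then show "exp (\<i> * of_real (pi / real n)) ^ n * of_real ((- c) ^ (n - 1))
        = of_real (- ((- c) ^ (n - 1)))"
      by simp
  qed (simp add: f2_integrand_def)
  moreover have "integral_defined (g2_integrand n c k) \<and> scorer_solution n c (g2 n c k)" for k
    unfolding g2_def[abs_def]
  \<comment> \<open>Now \<open>n * t\<close> is an odd multiple of \<open>pi\<close>, so
    \<open>cis t\<close> is an \<open>n\<close>-th root of -1.\<close>
  proof (rule cosine_integral_solution[OF assms(1) A, where t = "(2 * real k + 1) * pi / real n"])
    have "real n * ((2 * real k + 1) * pi / real n) = pi + 2 * pi * real k"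
      using assms(1) by (simp add: field_simps)
    then have "cis (real n * ((2 * real k + 1) * pi / real n)) = cis pi * cis (2 * pi * real k)"
      by (simp only: cis_mult)
    also have "\<dots> = - 1"
      by (simp add: cis_multiple_2pi)
    finally have "cis (real n * ((2 * real k + 1) * pi / real n)) = - 1" .
    then show "cis (real n * ((2 * real k + 1) * pi / real n)) * of_real ((- c) ^ (n - 1))
        = of_real (- ((- c) ^ (n - 1)))"
      by simp
  qed (simp add: g2_integrand_def Let_def)
  ultimately show "(integral_defined (f2_integrand n c) \<and> scorer_solution n c (f2 n c)) \<and>
        (\<forall>k\<in>{0..n div 2 - 1}.
           integral_defined (g2_integrand n c k) \<and> scorer_solution n c (g2 n c k))"
    by blast
qed

end
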